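(* Let $n\ge 1$ and let $(\Sigma^n,\partial\Sigma)$ be a properly immersed connected self-translating $n$-dimensional hypersurface (possibly with boundary) in $\mathbb{R}^{n+1}$ which is contained in two transverse vertical halfspaces of $\mathbb{R}^{n+1}$. If $\partial\Sigma$ is compact, then $\Sigma$ is compact.
   Context: A self-translating hypersurface (self-translater) $\Sigma^n\subseteq\mathbb{R}^{n+1}$ is a smooth immersed hypersurface, possibly with boundary, satisfying $\boldsymbol{H}=\langle e_{n+1},\nu\rangle\,\nu$, where $\boldsymbol{H}$ is the mean curvature vector (the trace of the vector-valued second fundamental form $A(X,Y)=(\nabla^{\mathbb{R}^{n+1}}_XY)^\perp$), $\nu$ is a (local) unit normal, and $e_{n+1}$ is the last standard basis vector; equivalently $\boldsymbol{H}=e_{n+1}^\perp$. "Contained in" refers to the image of the immersion. A (closed, affine) halfspace is $H_{(b,w)}=\{x\in\mathbb{R}^{n+1}:\langle x-b,w\rangle\ge 0\}$ with $b\in\mathbb{R}^{n+1}$ and $w\in\mathbb{S}^n$ a unit vector. It is vertical if $\langle w,e_{n+1}\rangle=0$. Two halfspaces $H_{(b_1,w_1)},H_{(b_2,w_2)}$ are transverse if $w_1$ and $w_2$ are neither parallel nor antiparallel, i.e. $w_1\neq\pm w_2$. The hypersurface is contained in two transverse vertical halfspaces if $\Sigma\subseteq H_1\cap H_2$ for some such pair. *)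

theory Defs
  imports "HOL-Analysis.Analysis"
begin

text \<open>Smooth maps. On an open set \<open>W\<close>, \<open>Ck_on k W f\<close> says that \<open>f\<close> is of class \<open>C^k\<close>. A map on
  an arbitrary set is smooth if locally it has \<open>C^\<infinity>\<close> extensions to open sets; this is used for
  relatively open subsets of a closed half-space.\<close>

primrec Ck_on :: "nat \<Rightarrow> 'a::euclidean_space set \<Rightarrow> ('a \<Rightarrow> 'b::euclidean_space) \<Rightarrow> bool" where
  "Ck_on 0 W f \<longleftrightarrow> continuous_on W f"
| "Ck_on (Suc k) W f \<longleftrightarrow> (\<forall>x\<in>W. f differentiable (at x)) \<and>
     (\<forall>v. Ck_on k W (\<lambda>x. frechet_derivative f (at x) v))"

definition smooth_on :: "'a::euclidean_space set \<Rightarrow> ('a \<Rightarrow> 'b::euclidean_space) \<Rightarrow> bool" where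
  "smooth_on V f \<longleftrightarrow> (\<forall>x\<in>V. \<exists>W g. open W \<and> x \<in> W \<and> (\<forall>k. Ck_on k W g) \<and> (\<forall>y\<in>W \<inter> V. g y = f y))"

text \<open>Directional derivative within \<open>V\<close>. It is only used at points of relatively open subsets \<open>V\<close> of
  a closed half-space with non-empty interior, where derivatives within \<open>V\<close> are unique; at boundary
  points it coincides with the derivative of any smooth extension.\<close>

definition dir_deriv ::
  "'a::euclidean_space set \<Rightarrow> ('a \<Rightarrow> 'b::euclidean_space) \<Rightarrow> 'a \<Rightarrow> 'a \<Rightarrow> 'b" where
  "dir_deriv V f v x = frechet_derivative f (at x within V) v"


text \<open>Manifolds with boundary of dimension \<open>CARD('n)\<close>, given by an atlas of charts with values in the
  half-space \<open>{x. 0 \<le> x $ i}\<close>; which coordinate \<open>i\<close> is used is immaterial.\<close>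

definition bd_index :: "'n::finite" where
  "bd_index = (SOME i. True)"

definition model_halfspace :: "(real ^ 'n) set" where
  "model_halfspace = {x. 0 \<le> x $ bd_index}"

type_synonym ('m, 'n) chart = "'m set \<times> ('m \<Rightarrow> real ^ 'n)"

definition is_chart :: "'m topology \<Rightarrow> ('m, 'n::finite) chart \<Rightarrow> bool" where
  "is_chart M = (\<lambda>(U, \<phi>). openin M U \<and> openin (top_of_set model_halfspace) (\<phi> ` U) \<and>
     homeomorphic_map (subtopology M U) (top_of_set (\<phi> ` U)) \<phi>)"

locale smooth_manifold_with_boundary =
  fixes M :: "'m topology" and \<A> :: "('m, 'n::finite) chart set"
  assumes Hausdorff: "Hausdorff_space M"
    and second_countable: "second_countable M"
    and charts: "\<And>c. c \<in> \<A> \<Longrightarrow> is_chart M c"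
    and cover: "(\<Union>(U, \<phi>)\<in>\<A>. U) = topspace M"
    and compatible: "\<And>U \<phi> U' \<phi>'. (U, \<phi>) \<in> \<A> \<Longrightarrow> (U', \<phi>') \<in> \<A> \<Longrightarrow>
      smooth_on (\<phi> ` (U \<inter> U')) (\<phi>' \<circ> inv_into U \<phi>)"

definition manifold_boundary :: "('m, 'n::finite) chart set \<Rightarrow> 'm set" where
  "manifold_boundary \<A> = {p. \<exists>(U, \<phi>)\<in>\<A>. p \<in> U \<and> \<phi> p $ bd_index = 0}"


text \<open>Hypersurfaces in \<open>\<real>\<^sup>n\<^sup>+\<^sup>1\<close>, which is represented as \<open>(real ^ 'n) \<times> real\<close> with the
  Euclidean inner product of the product type; its last standard basis vector is \<open>(0, 1)\<close>.\<close>

definition e_last :: "(real ^ 'n) \<times> real" where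
  "e_last = (0, 1)"

definition normal_part :: "'a::euclidean_space set \<Rightarrow> 'a \<Rightarrow> 'a" where
  "normal_part T w = (THE u. u \<in> orthogonal_comp T \<and> w - u \<in> T)"

text \<open>Extrinsic geometry of a local parametrization \<open>X\<close> defined on \<open>V\<close>, at the parameter \<open>x\<close>.\<close>

definition tangent_space_at ::
  "(real ^ 'n) set \<Rightarrow> (real ^ 'n \<Rightarrow> (real ^ 'n) \<times> real) \<Rightarrow> real ^ 'n \<Rightarrow> ((real ^ 'n) \<times> real) set" where
  "tangent_space_at V X x = range (\<lambda>v. dir_deriv V X v x)"

definition is_unit_normal ::
  "(real ^ 'n) set \<Rightarrow> (real ^ 'n \<Rightarrow> (real ^ 'n) \<times> real) \<Rightarrow> real ^ 'n \<Rightarrow> (real ^ 'n) \<times> real \<Rightarrow> bool" where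
  "is_unit_normal V X x \<nu> \<longleftrightarrow> norm \<nu> = 1 \<and> \<nu> \<in> orthogonal_comp (tangent_space_at V X x)"

text \<open>\<open>A(dX v, dX w)\<close>, evaluated on the coordinate fields with constant coefficients \<open>v\<close> and \<open>w\<close>.\<close>

definition second_fundamental_form ::
  "(real ^ 'n) set \<Rightarrow> (real ^ 'n \<Rightarrow> (real ^ 'n) \<times> real) \<Rightarrow> real ^ 'n \<Rightarrow> real ^ 'n \<Rightarrow> real ^ 'n
    \<Rightarrow> (real ^ 'n) \<times> real" where
  "second_fundamental_form V X x v w =
     normal_part (tangent_space_at V X x) (dir_deriv V (dir_deriv V X w) v x)"

definition induced_metric ::
  "(real ^ 'n) set \<Rightarrow> (real ^ 'n \<Rightarrow> (real ^ 'n) \<times> real) \<Rightarrow> real ^ 'n \<Rightarrow> real ^ 'n ^ 'n" where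
  "induced_metric V X x = (\<chi> i j. dir_deriv V X (axis i 1) x \<bullet> dir_deriv V X (axis j 1) x)"

definition mean_curvature_vector ::
  "(real ^ 'n) set \<Rightarrow> (real ^ 'n \<Rightarrow> (real ^ 'n) \<times> real) \<Rightarrow> real ^ 'n \<Rightarrow> (real ^ 'n) \<times> real" where
  "mean_curvature_vector V X x =
     (\<Sum>i\<in>UNIV. \<Sum>j\<in>UNIV. (matrix_inv (induced_metric V X x) $ i $ j) *\<^sub>R
        second_fundamental_form V X x (axis i 1) (axis j 1))"

locale immersed_hypersurface = smooth_manifold_with_boundary M \<A>
  for M :: "'m topology" and \<A> :: "('m, 'n::finite) chart set" +
  fixes F :: "'m \<Rightarrow> (real ^ 'n) \<times> real"
  assumes smooth: "\<And>U \<phi>. (U, \<phi>) \<in> \<A> \<Longrightarrow> smooth_on (\<phi> ` U) (F \<circ> inv_into U \<phi>)"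
    and immersion: "\<And>U \<phi> x. (U, \<phi>) \<in> \<A> \<Longrightarrow> x \<in> \<phi> ` U \<Longrightarrow>
      inj (\<lambda>v. dir_deriv (\<phi> ` U) (F \<circ> inv_into U \<phi>) v x)"

text \<open>The right-hand side below does not depend on the choice between the two unit normals.\<close>

locale self_translater = immersed_hypersurface M \<A> F
  for M :: "'m topology" and \<A> :: "('m, 'n::finite) chart set" and F :: "'m \<Rightarrow> (real ^ 'n) \<times> real" +
  assumes translater: "\<And>U \<phi> x \<nu>. (U, \<phi>) \<in> \<A> \<Longrightarrow> x \<in> \<phi> ` U \<Longrightarrow>
      is_unit_normal (\<phi> ` U) (F \<circ> inv_into U \<phi>) x \<nu> \<Longrightarrow>
      mean_curvature_vector (\<phi> ` U) (F \<circ> inv_into U \<phi>) x = (e_last \<bullet> \<nu>) *\<^sub>R \<nu>"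


definition halfspace :: "'a::real_inner \<Rightarrow> 'a \<Rightarrow> 'a set" where
  "halfspace b w = {x. 0 \<le> (x - b) \<bullet> w}"

definition vertical_direction :: "(real ^ 'n) \<times> real \<Rightarrow> bool" where
  "vertical_direction w \<longleftrightarrow> norm w = 1 \<and> w \<bullet> e_last = 0"

definition in_two_transverse_vertical_halfspaces :: "((real ^ 'n) \<times> real) set \<Rightarrow> bool" where
  "in_two_transverse_vertical_halfspaces S \<longleftrightarrow>
     (\<exists>b\<^sub>1 w\<^sub>1 b\<^sub>2 w\<^sub>2. vertical_direction w\<^sub>1 \<and> vertical_direction w\<^sub>2 \<and> w\<^sub>1 \<noteq> w\<^sub>2 \<and> w\<^sub>1 \<noteq> - w\<^sub>2 \<and>
        S \<subseteq> halfspace b\<^sub>1 w\<^sub>1 \<inter> halfspace b\<^sub>2 w\<^sub>2)"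

end

theory Submission
  imports Defs
begin

text \<open>
  On a translater the natural operator on functions is the drift Laplacian, the Laplacian plus the
  derivative in the direction of the tangential part of \<open>e_last\<close>. For the restriction of an ambient
  function \<open>f\<close> it equals the trace of the Hessian of \<open>f\<close> over the tangent space plus the derivative of
  \<open>f\<close> along \<open>e_last\<close>, because the mean curvature vector is the normal part of \<open>e_last\<close>. Hence ambient
  functions give barriers: by \<open>strict_subsolution_boundary_bound\<close>, a function with positive drift
  Laplacian and compact superlevel sets attains its maximum on the boundary of the hypersurface only.

  Let \<open>w\<^sub>1, w\<^sub>2\<close> be the inner normals of the two halfspaces and \<open>v = w\<^sub>1 + w\<^sub>2\<close>, so that \<open>v \<bullet> x\<close> is
  bounded below on the hypersurface and measures the distance from the edge of the wedge. Three barriers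
  show that a proper translater in the wedge with compact boundary, contained in the ball of radius
  \<open>\<rho>\<close> about the origin, is bounded.

  \<^item> The part with \<open>v \<bullet> x \<le> C\<close> is bounded for every \<open>C\<close> (\<open>bounded_near_vertex\<close>). The barrier is the
    square of a distance in the wedge to a point far from the edge, minus a small multiple of the
    logarithm of the distance to a hypothetical point of the hypersurface far away. Transversality
    makes the trace of the Hessian of the square uniformly positive.

  \<^item> The height \<open>e_last \<bullet> x\<close> is at most \<open>\<rho>\<close>. The barrier is \<open>- (v \<bullet> x) - c exp (- (e_last \<bullet> x) / 2)\<close> with
    \<open>c\<close> large; its superlevel sets lie in sets \<open>v \<bullet> x \<le> C\<close> and are compact by the first step.

  \<^item> Finally \<open>v \<bullet> x \<le> 2 \<rho> + 1\<close>. The barrier is \<open>v \<bullet> x - c exp ((v \<bullet> x) / 8 - (e_last \<bullet> x) / 2)\<close>. As the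
    height is bounded above, the exponential beats the linear term, so again superlevel sets lie in sets
    \<open>v \<bullet> x \<le> C\<close>.

  The first step with \<open>C = 2 \<rho> + 1\<close> now bounds the whole hypersurface, and properness turns this into
  compactness.
\<close>

section \<open>Adapted orthonormal frames\<close>

text \<open>Orthonormal tangent vectors together with a unit normal: the setting in which the trace of a
  bilinear form over a tangent hyperplane is computed as a sum over the frame.\<close>

definition adapted_frame :: "('n::finite \<Rightarrow> 'a::euclidean_space) \<Rightarrow> 'a \<Rightarrow> bool" where
  "adapted_frame u \<nu> \<longleftrightarrow>
     (\<forall>i j. u i \<bullet> u j = (if i = j then 1 else 0)) \<and> (\<forall>i. u i \<bullet> \<nu> = 0) \<and> norm \<nu> = 1"

lemma adapted_frame_expansion:
  fixes u :: "'n::finite \<Rightarrow> 'a::euclidean_space"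
  assumes "adapted_frame u \<nu>" and dim: "DIM('a) = CARD('n) + 1"
  shows "a = (\<Sum>i\<in>UNIV. (a \<bullet> u i) *\<^sub>R u i) + (a \<bullet> \<nu>) *\<^sub>R \<nu>"
proof -
  have uu: "u i \<bullet> u j = (if i = j then 1 else 0)" and un: "u i \<bullet> \<nu> = 0" "\<nu> \<bullet> u i = 0"
    and nn: "\<nu> \<bullet> \<nu> = 1" for i j
    using assms by (auto simp: adapted_frame_def norm_eq_1 inner_commute)
  let ?S = "insert \<nu> (range u)"
  have inj: "inj u"
  proof (rule injI)
    fix i j assume "u i = u j"
    then have "u i \<bullet> u j = 1" using uu[of i i] by simp
    then show "i = j" using uu[of i j] by (auto split: if_splits)
  qed
  have "\<nu> \<notin> range u" using un nn by force
  then have card: "card ?S = DIM('a)" using inj dim by (simp add: card_image)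
  have "pairwise orthogonal ?S"
    by (auto simp: pairwise_def orthogonal_def uu un)
  moreover have "0 \<notin> ?S"
  proof
    assume "0 \<in> ?S"
    then consider "\<nu> = 0" | i where "u i = 0" by auto
    then show False using nn uu[of i i for i] by cases (simp, metis inner_zero_left zero_neq_one)
  qed
  ultimately have "independent ?S" by (rule pairwise_orthogonal_independent)
  then have span: "span ?S = UNIV"
    by (metis card card_eq_dim dim_UNIV dim_eq_full subset_UNIV dim_eq_card_independent)
  define r where "r = a - ((\<Sum>i\<in>UNIV. (a \<bullet> u i) *\<^sub>R u i) + (a \<bullet> \<nu>) *\<^sub>R \<nu>)"
  have "orthogonal r y" if "y \<in> ?S" for y
    using that by (auto simp: r_def orthogonal_def inner_diff_left inner_add_left inner_sum_left
        uu un nn if_distrib cong: if_cong)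
  then have "orthogonal r r"
    using orthogonal_to_span[of r ?S r] span by auto
  then show ?thesis by (simp add: r_def orthogonal_self)
qed

text \<open>With \<open>a \<bullet> u i\<close> the tangential components of \<open>a\<close>, this evaluates the trace of
  \<open>a \<otimes> a\<close> over the tangent hyperplane as \<open>(norm a)\<^sup>2 - (a \<bullet> \<nu>)\<^sup>2\<close>.\<close>

lemma adapted_frame_norm:
  fixes u :: "'n::finite \<Rightarrow> 'a::euclidean_space"
  assumes "adapted_frame u \<nu>" and dim: "DIM('a) = CARD('n) + 1"
  shows "(\<Sum>i\<in>UNIV. (a \<bullet> u i)\<^sup>2) + (a \<bullet> \<nu>)\<^sup>2 = (norm a)\<^sup>2"
proof -
  have "(norm a)\<^sup>2 = a \<bullet> a" by (simp add: power2_norm_eq_inner)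
  also have "\<dots> = a \<bullet> ((\<Sum>i\<in>UNIV. (a \<bullet> u i) *\<^sub>R u i) + (a \<bullet> \<nu>) *\<^sub>R \<nu>)"
    using adapted_frame_expansion[OF assms, of a] by simp
  finally show ?thesis
    by (simp add: inner_add_right inner_sum_right power2_eq_square)
qed

lemma adapted_frame_exists:
  fixes T :: "'a::euclidean_space set"
  assumes "subspace T" "dim T = CARD('n::finite)" "DIM('a) = CARD('n::finite) + 1"
  obtains u :: "'n::finite \<Rightarrow> 'a" and \<nu> where "adapted_frame u \<nu>" "range u \<subseteq> T" "\<nu> \<in> T\<^sup>\<bottom>"
proof -
  obtain B where B: "B \<subseteq> T" "pairwise orthogonal B" "\<And>x. x \<in> B \<Longrightarrow> norm x = 1"
    "independent B" "card B = dim T"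
    using orthonormal_basis_subspace[OF assms(1)] by metis
  have "finite B" using B(4) independent_imp_finite by blast
  then obtain u where u: "bij_betw u (UNIV::'n set) B"
    using finite_same_card_bij[of "UNIV::'n set" B] B(5) assms(2) by auto
  obtain z where z: "z \<noteq> 0" "\<And>y. y \<in> span T \<Longrightarrow> orthogonal z y"
    using orthogonal_to_subspace_exists[of T] assms by auto
  define \<nu> where "\<nu> = z /\<^sub>R norm z"
  have \<nu>: "y \<bullet> \<nu> = 0" if "y \<in> T" for y
    using z that by (auto simp: \<nu>_def orthogonal_def inner_commute span_base)
  have uB: "u i \<in> B" for i using u by (auto simp: bij_betw_def)
  have "u i \<bullet> u j = (if i = j then 1 else 0)" for i j
  proof (cases "i = j")
    case True then show ?thesis using B(3)[OF uB[of i]] by (simp add: norm_eq_1)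
  next
    case False
    then have "u i \<noteq> u j" using u by (auto simp: bij_betw_def inj_def)
    then show ?thesis using B(2) uB False by (auto simp: pairwise_def orthogonal_def)
  qed
  moreover have "norm \<nu> = 1" using z by (simp add: \<nu>_def)
  ultimately have "adapted_frame u \<nu>"
    using \<nu>[OF subsetD[OF B(1) uB]] by (simp add: adapted_frame_def)
  moreover have "\<nu> \<in> T\<^sup>\<bottom>" using \<nu> by (auto simp: orthogonal_comp_def orthogonal_def)
  moreover have "range u \<subseteq> T" using uB B(1) by auto
  ultimately show thesis using that by blast
qed

lemma normal_part_properties:
  fixes T :: "'a::euclidean_space set"
  assumes "subspace T"
  shows "normal_part T w \<in> T\<^sup>\<bottom>" "w - normal_part T w \<in> T"
proof -
  obtain y z where yz: "y \<in> span T" "\<And>v. v \<in> span T \<Longrightarrow> orthogonal z v" "w = y + z"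
    using orthogonal_subspace_decomp_exists[of T w] by metis
  have T: "span T = T" using assms by (simp add: span_eq_iff)
  have "normal_part T w \<in> T\<^sup>\<bottom> \<and> w - normal_part T w \<in> T"
    unfolding normal_part_def
  proof (rule theI)
    show "z \<in> T\<^sup>\<bottom> \<and> w - z \<in> T"
      using yz T by (auto simp: orthogonal_comp_def orthogonal_commute)
    fix u assume u: "u \<in> T\<^sup>\<bottom> \<and> w - u \<in> T"
    have "(w - z) - (w - u) \<in> T"
      by (rule subspace_diff[OF assms]) (use u yz T in auto)
    then have "u - z \<in> T" by simp
    moreover have "u - z \<in> T\<^sup>\<bottom>"
      by (rule subspace_diff[OF subspace_orthogonal_comp])
        (use u yz T in \<open>auto simp: orthogonal_comp_def orthogonal_commute\<close>)
    ultimately show "u = z" by (auto simp: orthogonal_comp_def orthogonal_self)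
  qed
  then show "normal_part T w \<in> T\<^sup>\<bottom>" "w - normal_part T w \<in> T" by auto
qed

text \<open>If \<open>P\<close> maps the vectors \<open>b k\<close> to an orthonormal family and \<open>B\<close> has the rows \<open>b k\<close>, then
  the Gram matrix \<open>G\<close> of \<open>P\<close> satisfies \<open>B G B\<^sup>T = 1\<close>, so that its inverse is \<open>B\<^sup>T B\<close>. This turns the
  contraction with the inverse metric that defines the mean curvature into a sum of second
  derivatives in the directions \<open>b k\<close>.\<close>

lemma inverse_gram_matrix:
  fixes P :: "real ^ 'n \<Rightarrow> 'a::euclidean_space" and b :: "'n \<Rightarrow> real ^ 'n"
  assumes "linear P" and orth: "\<And>i j. P (b i) \<bullet> P (b j) = (if i = j then 1 else 0)"
  shows "matrix_inv (\<chi> i j. P (axis i 1) \<bullet> P (axis j 1)) $ i $ j = (\<Sum>k\<in>UNIV. b k $ i * b k $ j)"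
proof -
  define G :: "real ^ 'n ^ 'n" where "G = (\<chi> i j. P (axis i 1) \<bullet> P (axis j 1))"
  define B :: "real ^ 'n ^ 'n" where "B = (\<chi> k. b k)"
  have P: "P v = (\<Sum>i\<in>UNIV. (v $ i) *\<^sub>R P (axis i 1))" for v
  proof -
    have "P v = P (\<Sum>i\<in>UNIV. (v $ i) *\<^sub>R axis i 1)"
      using basis_expansion[of v] by (simp add: scalar_mult_eq_scaleR)
    then show ?thesis using \<open>linear P\<close> by (simp add: linear_sum linear_scale)
  qed
  have "(B ** (G ** transpose B)) $ k $ l = P (b k) \<bullet> P (b l)" for k l
    by (subst P[of "b k"], subst P[of "b l"]) (simp add: matrix_matrix_mult_def B_def G_def
        transpose_def inner_sum_left inner_sum_right sum_distrib_left ac_simps, rule sum.swap)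
  then have "B ** (G ** transpose B) = mat 1"
    by (simp add: vec_eq_iff mat_def orth)
  then have "(G ** transpose B) ** B = mat 1"
    using matrix_left_right_inverse by blast
  then have GB: "G ** (transpose B ** B) = mat 1"
    by (simp add: matrix_mul_assoc)
  then have "invertible G" using invertible_right_inverse by blast
  then have "G ** matrix_inv G = mat 1 \<and> matrix_inv G ** G = mat 1"
    unfolding matrix_inv_def invertible_def by (rule someI_ex)
  then have "matrix_inv G = transpose B ** B"
    by (metis GB matrix_mul_assoc matrix_mul_lid matrix_mul_rid)
  then show ?thesis
    unfolding G_def[symmetric]
    by (simp add: matrix_matrix_mult_def transpose_def B_def)
qed

section \<open>The maximum principle on translaters\<close>

lemma second_derivative_nonpos_at_local_max:
  fixes h h' :: "real \<Rightarrow> real"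
  assumes "e > 0" and h: "\<And>t. \<bar>t\<bar> < e \<Longrightarrow> (h has_real_derivative h' t) (at t)"
    and m: "(h' has_real_derivative m) (at 0)" and max: "\<And>t. \<bar>t\<bar> < e \<Longrightarrow> h t \<le> h 0"
  shows "m \<le> 0"
proof (rule ccontr)
  assume "\<not> m \<le> 0"
  have "h' 0 = 0"
    using DERIV_local_max[of h "h' 0" 0 e] h[of 0] max \<open>e > 0\<close> by auto
  with DERIV_pos_inc_right[OF m] \<open>\<not> m \<le> 0\<close>
  obtain d where d: "d > 0" "\<And>k. 0 < k \<Longrightarrow> k < d \<Longrightarrow> 0 < h' k" by auto
  define t where "t = min d e / 2"
  have t: "0 < t" "t < d" "t < e" using d \<open>e > 0\<close> by (auto simp: t_def)
  obtain s where s: "0 < s" "s < t" "h t - h 0 = (t - 0) * h' s"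
    using MVT2[of 0 t h h'] h t by auto
  then have "0 < t * h' s" using d(2)[of s] t by auto
  with s(3) max[of t] t show False by auto
qed

text \<open>Smoothness and the directional derivatives refer to a set \<open>V\<close> that may contain boundary points
  of the half-space. At an interior point the smooth extension agrees with \<open>X\<close> on a neighbourhood,
  which makes these derivatives ordinary ones to which the chain rule applies.\<close>

lemma interior_parametrization_derivatives:
  fixes X :: "'a::euclidean_space \<Rightarrow> 'b::euclidean_space"
  assumes "smooth_on V X" "x\<^sub>0 \<in> interior V"
  obtains N where "open N" "x\<^sub>0 \<in> N" "N \<subseteq> V"
    "\<And>x. x \<in> N \<Longrightarrow> (X has_derivative (\<lambda>v. dir_deriv V X v x)) (at x)"
    "\<And>w. (dir_deriv V X w has_derivative (\<lambda>v. dir_deriv V (dir_deriv V X w) v x\<^sub>0)) (at x\<^sub>0)"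
proof -
  have "x\<^sub>0 \<in> V" using assms(2) interior_subset by blast
  with assms(1) have "\<exists>W g. open W \<and> x\<^sub>0 \<in> W \<and> (\<forall>k. Ck_on k W g) \<and> (\<forall>y\<in>W \<inter> V. g y = X y)"
    unfolding smooth_on_def by (rule bspec)
  then obtain W g where "open W \<and> x\<^sub>0 \<in> W \<and> (\<forall>k. Ck_on k W g) \<and> (\<forall>y\<in>W \<inter> V. g y = X y)"
    by (elim exE)
  then have W: "open W" "x\<^sub>0 \<in> W" "Ck_on k W g" "y \<in> W \<inter> V \<Longrightarrow> g y = X y" for k y
    by simp_all
  define N where "N = W \<inter> interior V"
  have N: "open N" "x\<^sub>0 \<in> N" "N \<subseteq> V" using W assms interior_subset by (auto simp: N_def)
  have at: "at x within V = at x" if "x \<in> N" for x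
    using that by (intro at_within_interior) (auto simp: N_def)
  have 1: "(X has_derivative frechet_derivative g (at x)) (at x)" if "x \<in> N" for x
  proof (rule has_derivative_transform_within_open[OF _ N(1) that])
    show "(g has_derivative frechet_derivative g (at x)) (at x)"
      using W(3)[of 1] that by (simp add: N_def frechet_derivative_works)
    show "g y = X y" if "y \<in> N" for y using that W(4) N by (auto simp: N_def)
  qed
  have eq: "dir_deriv V X v x = frechet_derivative g (at x) v" if "x \<in> N" for v x
    using frechet_derivative_at[OF 1[OF that]] by (simp add: dir_deriv_def at[OF that])
  show thesis
  proof (rule that[OF N])
    show "(X has_derivative (\<lambda>v. dir_deriv V X v x)) (at x)" if "x \<in> N" for x
      using 1[OF that] eq[OF that] by simp
    fix w
    have "Ck_on (Suc (Suc 0)) W g" by (rule W(3))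
    then have "(\<lambda>x. frechet_derivative g (at x) w) differentiable (at x\<^sub>0)"
      using W(2) by simp
    then obtain D where D: "((\<lambda>x. frechet_derivative g (at x) w) has_derivative D) (at x\<^sub>0)"
      by (auto simp: differentiable_def)
    have "(dir_deriv V X w has_derivative D) (at x\<^sub>0)"
      by (rule has_derivative_transform_within_open[OF D N(1,2)]) (simp add: eq)
    then show "(dir_deriv V X w has_derivative (\<lambda>v. dir_deriv V (dir_deriv V X w) v x\<^sub>0)) (at x\<^sub>0)"
      using frechet_derivative_at by (force simp: dir_deriv_def at[OF N(2)])
  qed
qed

text \<open>At the parameter \<open>x\<^sub>0\<close> of a local maximum of \<open>f \<circ> X\<close>, the second derivative of \<open>f\<close> along
  each curve \<open>t \<mapsto> X (x\<^sub>0 + t v)\<close> is non-positive; it is the Hessian of \<open>f\<close> at \<open>dX v\<close> plus the gradient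
  paired with the acceleration. Choosing the \<open>v\<close> that correspond to an orthonormal tangent frame and
  summing, the accelerations add up to the mean curvature vector modulo tangent vectors. The gradient
  is normal at the maximum, hence a multiple of \<open>\<nu>\<close>, and the translater equation
  replaces the mean curvature vector by \<open>e_last\<close>. The conclusion says that the drift Laplacian
  of \<open>f\<close> is non-positive.\<close>

lemma maximum_principle_in_parametrization:
  fixes X :: "real ^ 'n \<Rightarrow> (real ^ 'n) \<times> real" and f :: "(real ^ 'n) \<times> real \<Rightarrow> real"
  assumes smooth: "smooth_on V X" and x\<^sub>0: "x\<^sub>0 \<in> interior V"
    and inj: "inj (\<lambda>v. dir_deriv V X v x\<^sub>0)"
    and translater: "\<And>\<nu>. is_unit_normal V X x\<^sub>0 \<nu> \<Longrightarrow>
      mean_curvature_vector V X x\<^sub>0 = (e_last \<bullet> \<nu>) *\<^sub>R \<nu>"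
    and f: "\<And>y. (f has_derivative (\<lambda>h. g y \<bullet> h)) (at y)"
    and g: "(g has_derivative H) (at (X x\<^sub>0))"
    and D: "open D" "X x\<^sub>0 \<in> D" and max: "\<And>x. x \<in> V \<Longrightarrow> X x \<in> D \<Longrightarrow> f (X x) \<le> f (X x\<^sub>0)"
  shows "\<exists>u \<nu>. adapted_frame (u :: 'n \<Rightarrow> _) \<nu> \<and> (\<Sum>k\<in>UNIV. H (u k) \<bullet> u k) + g (X x\<^sub>0) \<bullet> e_last \<le> 0"
proof -
  define P where "P = (\<lambda>v x. dir_deriv V X v x)"
  define S where "S = (\<lambda>w v. dir_deriv V (dir_deriv V X w) v x\<^sub>0)"
  obtain N where N: "open N" "x\<^sub>0 \<in> N" "N \<subseteq> V"
    and dX: "\<And>x. x \<in> N \<Longrightarrow> (X has_derivative (\<lambda>v. P v x)) (at x)"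
    and dP: "\<And>w. (P w has_derivative S w) (at x\<^sub>0)"
    using interior_parametrization_derivatives[OF smooth x\<^sub>0] unfolding P_def S_def by metis
  have linP: "linear (\<lambda>v. P v x)" if "x \<in> N" for x
    using dX[OF that] has_derivative_linear by blast
  have linS: "linear (S w)" for w
    using dP has_derivative_linear by blast
  have exp: "v = (\<Sum>i\<in>UNIV. (v $ i) *\<^sub>R axis i 1)" for v :: "real ^ 'n"
    using basis_expansion[of v] by (simp add: scalar_mult_eq_scaleR)
  have Pexp: "P v x = (\<Sum>i\<in>UNIV. (v $ i) *\<^sub>R P (axis i 1) x)" if "x \<in> N" for v x
    by (subst exp[of v]) (simp add: linear_sum[OF linP[OF that]] linear_scale[OF linP[OF that]])
  have Sexp: "S w v = (\<Sum>j\<in>UNIV. (v $ j) *\<^sub>R S w (axis j 1))" for v w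
    by (subst exp[of v]) (simp add: linear_sum[OF linS] linear_scale[OF linS])
  define T where "T = tangent_space_at V X x\<^sub>0"
  have T: "T = range (\<lambda>v. P v x\<^sub>0)" by (simp add: T_def tangent_space_at_def P_def)
  have subT: "subspace T"
    unfolding T using linear_subspace_image[OF linP[OF N(2)] subspace_UNIV] by simp
  have "dim T = CARD('n)"
    unfolding T using dim_image_eq[OF linP[OF N(2)], of UNIV] inj by (simp add: P_def)
  then obtain u :: "'n \<Rightarrow> _" and \<nu> where u: "adapted_frame u \<nu>" "range u \<subseteq> T" "\<nu> \<in> T\<^sup>\<bottom>"
    using adapted_frame_exists[OF subT, where 'n='n] by auto
  have "\<forall>k. \<exists>v. u k = P v x\<^sub>0" using u(2) T by auto
  then obtain b where b: "\<And>k. u k = P (b k) x\<^sub>0" by metis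
  have inv: "matrix_inv (induced_metric V X x\<^sub>0) $ i $ j = (\<Sum>k\<in>UNIV. b k $ i * b k $ j)" for i j
    unfolding induced_metric_def P_def[symmetric]
    using inverse_gram_matrix[OF linP[OF N(2)], of b i j] u(1) b by (auto simp: adapted_frame_def)
  \<comment> \<open>\<open>\<gamma> v\<close> is the test line in parameter space and \<open>A v\<close> the acceleration of its image at \<open>t = 0\<close>.\<close>
  define \<gamma> where "\<gamma> = (\<lambda>v t. x\<^sub>0 + t *\<^sub>R v)"
  define A where "A = (\<lambda>v. \<Sum>i\<in>UNIV. (v $ i) *\<^sub>R S (axis i 1) v)"
  obtain N' where N': "open N'" "x\<^sub>0 \<in> N'" "N' \<subseteq> N" "\<And>x. x \<in> N' \<Longrightarrow> X x \<in> D"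
  proof -
    have "isCont X x\<^sub>0" using dX[OF N(2)] has_derivative_continuous by blast
    then obtain Q where "open Q" "x\<^sub>0 \<in> Q" "\<And>x. x \<in> Q \<Longrightarrow> X x \<in> D"
      using D by (metis continuous_at_open)
    then show thesis using N by (intro that[of "N \<inter> Q"]) auto
  qed
  have second: "H (P v x\<^sub>0) \<bullet> P v x\<^sub>0 + g (X x\<^sub>0) \<bullet> A v \<le> 0"
    and first: "g (X x\<^sub>0) \<bullet> P v x\<^sub>0 = 0" for v
  proof -
    obtain e where e: "e > 0" "\<And>t. \<bar>t\<bar> < e \<Longrightarrow> \<gamma> v t \<in> N'"
    proof -
      have "open (\<gamma> v -` N')"
        by (rule open_vimage[OF N'(1)]) (auto simp: \<gamma>_def intro!: continuous_intros)
      moreover have "0 \<in> \<gamma> v -` N'" using N' by (simp add: \<gamma>_def)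
      ultimately obtain e where "e > 0" "ball 0 e \<subseteq> \<gamma> v -` N'"
        using open_contains_ball by blast
      then show thesis using that[of e] by (auto simp: subset_iff)
    qed
    have d\<gamma>: "(\<gamma> v has_derivative (\<lambda>s. s *\<^sub>R v)) (at t)" for t
      unfolding \<gamma>_def by (auto intro!: derivative_eq_intros)
    have dXg: "((\<lambda>t. X (\<gamma> v t)) has_derivative (\<lambda>s. s *\<^sub>R P v (\<gamma> v t))) (at t)" if "\<bar>t\<bar> < e" for t
    proof -
      have "\<gamma> v t \<in> N" using e(2)[OF that] N' by auto
      from has_derivative_compose[OF d\<gamma>, OF dX[OF this]]
      show ?thesis by (simp add: linear_scale[OF linP[OF \<open>\<gamma> v t \<in> N\<close>]])
    qed
    have h: "((\<lambda>t. f (X (\<gamma> v t))) has_real_derivative g (X (\<gamma> v t)) \<bullet> P v (\<gamma> v t)) (at t)"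
      if "\<bar>t\<bar> < e" for t
      using has_derivative_compose[OF dXg[OF that] f]
      by (simp add: has_field_derivative_def mult_commute_abs)
    have dPg: "((\<lambda>t. P v (\<gamma> v t)) has_derivative (\<lambda>s. s *\<^sub>R A v)) (at 0)"
    proof -
      have "((\<lambda>x. \<Sum>i\<in>UNIV. (v $ i) *\<^sub>R P (axis i 1) x) has_derivative
          (\<lambda>w. \<Sum>i\<in>UNIV. (v $ i) *\<^sub>R S (axis i 1) w)) (at x\<^sub>0)"
        by (intro has_derivative_sum has_derivative_scaleR_right dP)
      then have "(P v has_derivative (\<lambda>w. \<Sum>i\<in>UNIV. (v $ i) *\<^sub>R S (axis i 1) w)) (at x\<^sub>0)"
        by (rule has_derivative_transform_within_open[OF _ N(1,2)]) (simp add: Pexp[symmetric])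
      moreover have "\<gamma> v 0 = x\<^sub>0" by (simp add: \<gamma>_def)
      ultimately have "((\<lambda>t. P v (\<gamma> v t)) has_derivative
          (\<lambda>s. \<Sum>i\<in>UNIV. (v $ i) *\<^sub>R S (axis i 1) (s *\<^sub>R v))) (at 0)"
        using has_derivative_compose[OF d\<gamma>[of 0]] by simp
      then show ?thesis
        by (simp add: A_def linear_scale[OF linS] scaleR_sum_right mult.commute)
    qed
    have dgX: "((\<lambda>t. g (X (\<gamma> v t))) has_derivative (\<lambda>s. H (s *\<^sub>R P v x\<^sub>0))) (at 0)"
      using has_derivative_compose[OF dXg[of 0], of g H] g e(1) by (simp add: \<gamma>_def)
    have linH: "linear H" using g has_derivative_linear by blast
    have h': "((\<lambda>t. g (X (\<gamma> v t)) \<bullet> P v (\<gamma> v t)) has_real_derivative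
        H (P v x\<^sub>0) \<bullet> P v x\<^sub>0 + g (X x\<^sub>0) \<bullet> A v) (at 0)"
      using has_derivative_inner[OF dgX dPg]
      by (simp add: has_field_derivative_def \<gamma>_def linear_scale[OF linH] distrib_left[symmetric]
          add.commute mult_commute_abs)
    have max': "f (X (\<gamma> v t)) \<le> f (X (\<gamma> v 0))" if "\<bar>t\<bar> < e" for t
      using max e(2)[OF that] N' N by (auto simp: \<gamma>_def)
    show "H (P v x\<^sub>0) \<bullet> P v x\<^sub>0 + g (X x\<^sub>0) \<bullet> A v \<le> 0"
      by (rule second_derivative_nonpos_at_local_max[OF e(1) h h' max'])
    have "g (X (\<gamma> v 0)) \<bullet> P v (\<gamma> v 0) = 0"
      using DERIV_local_max[OF h[of 0] e(1)] e(1) max' by auto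
    then show "g (X x\<^sub>0) \<bullet> P v x\<^sub>0 = 0" by (simp add: \<gamma>_def)
  qed
  let ?g = "g (X x\<^sub>0)"
  have gu: "?g \<bullet> u k = 0" for k using first b by simp
  have g\<nu>: "?g = (?g \<bullet> \<nu>) *\<^sub>R \<nu>"
    using adapted_frame_expansion[OF u(1), of ?g] gu by simp
  \<comment> \<open>Pairing with the normal gradient does not see the projection in the second fundamental form.\<close>
  have gT: "?g \<bullet> normal_part T w = ?g \<bullet> w" for w
  proof -
    have "?g \<bullet> (w - normal_part T w) = 0"
      using normal_part_properties(2)[OF subT, of w] first by (auto simp: T)
    then show ?thesis by (simp add: inner_diff_right)
  qed
  have "is_unit_normal V X x\<^sub>0 \<nu>" using u by (simp add: is_unit_normal_def T_def adapted_frame_def)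
  from translater[OF this]
  have "?g \<bullet> mean_curvature_vector V X x\<^sub>0 = (e_last \<bullet> \<nu>) * (?g \<bullet> \<nu>)" by simp
  also have "\<dots> = ?g \<bullet> e_last" by (subst (2) g\<nu>) (simp add: inner_commute)
  finally have 1: "?g \<bullet> e_last = ?g \<bullet> mean_curvature_vector V X x\<^sub>0" ..
  also have "\<dots> = (\<Sum>i\<in>UNIV. \<Sum>j\<in>UNIV. (\<Sum>k\<in>UNIV. b k $ i * b k $ j) * (?g \<bullet> S (axis j 1) (axis i 1)))"
    by (simp add: mean_curvature_vector_def inv second_fundamental_form_def inner_sum_right gT
        T_def[symmetric] S_def)
  also have "\<dots> = (\<Sum>k\<in>UNIV. ?g \<bullet> A (b k))"
  proof -
    let ?t = "\<lambda>i j k. b k $ i * b k $ j * (?g \<bullet> S (axis j 1) (axis i 1))"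
    have "?g \<bullet> A (b k) = (\<Sum>i\<in>UNIV. \<Sum>j\<in>UNIV. b k $ i * b k $ j * (?g \<bullet> S (axis i 1) (axis j 1)))" for k
      unfolding A_def by (subst Sexp)
        (simp add: inner_sum_right sum_distrib_left mult.assoc scaleR_sum_right)
    then have "(\<Sum>k\<in>UNIV. ?g \<bullet> A (b k)) = (\<Sum>k\<in>UNIV. \<Sum>j\<in>UNIV. \<Sum>i\<in>UNIV. ?t i j k)"
      by (simp add: mult.commute)
    also have "\<dots> = (\<Sum>j\<in>UNIV. \<Sum>k\<in>UNIV. \<Sum>i\<in>UNIV. ?t i j k)" by (rule sum.swap)
    also have "\<dots> = (\<Sum>j\<in>UNIV. \<Sum>i\<in>UNIV. \<Sum>k\<in>UNIV. ?t i j k)"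
      by (intro sum.cong refl sum.swap)
    also have "\<dots> = (\<Sum>i\<in>UNIV. \<Sum>j\<in>UNIV. \<Sum>k\<in>UNIV. ?t i j k)" by (rule sum.swap)
    finally show ?thesis by (simp add: sum_distrib_right)
  qed
  finally have "(\<Sum>k\<in>UNIV. H (u k) \<bullet> u k) + ?g \<bullet> e_last
      = (\<Sum>k\<in>UNIV. H (P (b k) x\<^sub>0) \<bullet> P (b k) x\<^sub>0 + ?g \<bullet> A (b k))"
    by (simp add: b sum.distrib)
  also have "\<dots> \<le> 0" by (intro sum_nonpos second)
  finally show ?thesis using u(1) by blast
qed

lemma (in smooth_manifold_with_boundary) chart_around:
  assumes "p \<in> topspace M"
  obtains U \<phi> where "(U, \<phi>) \<in> \<A>" "p \<in> U" "openin M U"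
    "openin (top_of_set model_halfspace) (\<phi> ` U)"
    "continuous_map (subtopology M U) (top_of_set (\<phi> ` U)) \<phi>"
    "\<And>p'. p' \<in> U \<Longrightarrow> inv_into U \<phi> (\<phi> p') = p'"
proof -
  obtain U \<phi> where U: "(U, \<phi>) \<in> \<A>" "p \<in> U" using cover assms by blast
  have ch: "openin M U" "openin (top_of_set model_halfspace) (\<phi> ` U)"
    "homeomorphic_map (subtopology M U) (top_of_set (\<phi> ` U)) \<phi>"
    using charts[OF U(1)] by (auto simp: is_chart_def)
  have "U \<subseteq> topspace M" using ch(1) by (rule openin_subset)
  then have "inj_on \<phi> U"
    using homeomorphic_imp_injective_map[OF ch(3)] by (simp add: inf_absorb2)
  then show thesis
    using that[OF U ch(1,2)] homeomorphic_imp_continuous_map[OF ch(3)] by simp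
qed

lemma (in immersed_hypersurface) continuous_immersion: "continuous_map M euclidean F"
  unfolding continuous_map_eq_topcontinuous_at
proof
  fix p assume p: "p \<in> topspace M"
  obtain U \<phi> where U: "(U, \<phi>) \<in> \<A>" "p \<in> U" "openin M U"
    and cont: "continuous_map (subtopology M U) (top_of_set (\<phi> ` U)) \<phi>"
    and inv: "\<And>p'. p' \<in> U \<Longrightarrow> inv_into U \<phi> (\<phi> p') = p'"
    using chart_around[OF p] by metis
  define V where "V = \<phi> ` U"
  have UM: "U \<subseteq> topspace M" using U(3) by (rule openin_subset)
  have "continuous_on V (F \<circ> inv_into U \<phi>)"
    unfolding continuous_on_eq_continuous_within
  proof
    fix x assume "x \<in> V"
    then have "\<exists>W g. open W \<and> x \<in> W \<and> (\<forall>k. Ck_on k W g) \<and> (\<forall>y\<in>W \<inter> V. g y = (F \<circ> inv_into U \<phi>) y)"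
      using smooth[OF U(1)] unfolding smooth_on_def V_def[symmetric] by (rule bspec[rotated])
    then obtain W g where W: "open W \<and> x \<in> W \<and> (\<forall>k. Ck_on k W g) \<and>
        (\<forall>y\<in>W \<inter> V. g y = (F \<circ> inv_into U \<phi>) y)" by (elim exE)
    then have "Ck_on 0 W g" by blast
    then have "continuous_on W g" by simp
    then have "isCont g x" using W continuous_on_eq_continuous_at by blast
    then have "continuous (at x within V) g" by (rule continuous_at_imp_continuous_within)
    moreover have "\<forall>\<^sub>F y in at x within V. g y = (F \<circ> inv_into U \<phi>) y"
      using W unfolding eventually_at_topological by auto
    moreover have "g x = (F \<circ> inv_into U \<phi>) x" using W \<open>x \<in> V\<close> by simp
    ultimately show "continuous (at x within V) (F \<circ> inv_into U \<phi>)"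
      unfolding continuous_within using Lim_transform_eventually by fastforce
  qed
  then have "continuous_map (top_of_set V) euclidean (F \<circ> inv_into U \<phi>)" by simp
  from continuous_map_compose[OF cont[folded V_def] this]
  have "continuous_map (subtopology M U) euclidean F"
    by (rule continuous_map_eq) (use inv UM in auto)
  then have "topcontinuous_at (subtopology M U) euclidean F p"
    using U UM by (auto simp: continuous_map_eq_topcontinuous_at)
  then show "topcontinuous_at M euclidean F p"
    unfolding topcontinuous_at_def
    using p U(3) openin_open_subtopology[OF U(3)] by auto
qed

text \<open>A point off the manifold boundary lies in the interior of the image of any chart around it, since
  the image is relatively open in the half-space and the distinguished coordinate is positive there.\<close>

lemma (in self_translater) maximum_principle:
  assumes p: "p \<in> topspace M" "p \<notin> manifold_boundary \<A>"
    and f: "\<And>y. (f has_derivative (\<lambda>h. g y \<bullet> h)) (at y)"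
    and g: "(g has_derivative H) (at (F p))"
    and D: "open D" "F p \<in> D"
    and max: "\<And>p'. p' \<in> topspace M \<Longrightarrow> F p' \<in> D \<Longrightarrow> f (F p') \<le> f (F p)"
  shows "\<exists>u \<nu>. adapted_frame (u :: 'n \<Rightarrow> _) \<nu> \<and> (\<Sum>k\<in>UNIV. H (u k) \<bullet> u k) + g (F p) \<bullet> e_last \<le> 0"
proof -
  obtain U \<phi> where U: "(U, \<phi>) \<in> \<A>" "p \<in> U" "openin M U"
    and rel_open: "openin (top_of_set model_halfspace) (\<phi> ` U)"
    and inv: "\<And>p'. p' \<in> U \<Longrightarrow> inv_into U \<phi> (\<phi> p') = p'"
    using chart_around[OF p(1)] by metis
  define V where "V = \<phi> ` U"
  have ch: "openin (top_of_set model_halfspace) V" using rel_open by (simp add: V_def)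
  have UM: "U \<subseteq> topspace M" using U(3) by (rule openin_subset)
  have "\<phi> p \<in> V" using U by (simp add: V_def)
  have pos: "0 < \<phi> p $ bd_index"
  proof -
    have "V \<subseteq> model_halfspace" using openin_imp_subset[OF ch] .
    then have "0 \<le> \<phi> p $ bd_index" using \<open>\<phi> p \<in> V\<close> by (auto simp: model_halfspace_def)
    moreover have "\<phi> p $ bd_index \<noteq> 0" using p(2) U by (auto simp: manifold_boundary_def)
    ultimately show ?thesis by simp
  qed
  have int: "\<phi> p \<in> interior V"
  proof -
    obtain Q where Q: "open Q" "V = model_halfspace \<inter> Q" using ch by (auto simp: openin_open)
    have "open (Q \<inter> {x. 0 < x $ bd_index})"
      using Q(1) by (intro open_Int open_halfspace_component_gt_cart)
    moreover have "Q \<inter> {x. 0 < x $ bd_index} \<subseteq> V" using Q(2) by (auto simp: model_halfspace_def)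
    moreover have "\<phi> p \<in> Q \<inter> {x. 0 < x $ bd_index}" using Q(2) \<open>\<phi> p \<in> V\<close> pos by auto
    ultimately show ?thesis by (meson interior_maximal subsetD)
  qed
  let ?X = "F \<circ> inv_into U \<phi>"
  have X: "?X (\<phi> p) = F p" using inv U by simp
  have max': "f (?X x) \<le> f (?X (\<phi> p))" if "x \<in> V" "?X x \<in> D" for x
    unfolding X using that UM inv by (auto simp: V_def intro!: max)
  show ?thesis
    using maximum_principle_in_parametrization[OF smooth[OF U(1)] int[unfolded V_def]
        immersion[OF U(1) \<open>\<phi> p \<in> V\<close>[unfolded V_def]]
        translater[OF U(1) \<open>\<phi> p \<in> V\<close>[unfolded V_def]] f, of H D] g D max'
    by (simp add: X V_def inv U)
qed

text \<open>The form in which the maximum principle is used. Compactness of the superlevel set inside \<open>D\<close>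
  takes the place of compactness of the hypersurface: it holds when \<open>f\<close> tends to \<open>-\<infinity>\<close> at infinity
  and stays below \<open>f q\<close> on the frontier of \<open>D\<close>. The maximum is then attained, and strict positivity of
  the drift Laplacian forces it onto the boundary of the hypersurface.\<close>

lemma (in self_translater) strict_subsolution_boundary_bound:
  assumes f: "\<And>y. (f has_derivative (\<lambda>h. g y \<bullet> h)) (at y)"
    and g: "\<And>y. (g has_derivative H y) (at y)"
    and "open D" and q: "q \<in> F ` topspace M" "q \<in> D"
    and strict: "\<And>y (u :: 'n \<Rightarrow> _) \<nu>. adapted_frame u \<nu> \<Longrightarrow>
      0 < (\<Sum>k\<in>UNIV. H y (u k) \<bullet> u k) + g y \<bullet> e_last"
    and compact: "compact {y \<in> F ` topspace M \<inter> D. f q \<le> f y}"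
  obtains z where "z \<in> F ` manifold_boundary \<A>" "z \<in> D" "f q \<le> f z"
proof -
  let ?C = "{y \<in> F ` topspace M \<inter> D. f q \<le> f y}"
  have "continuous_on ?C f"
    using f has_derivative_continuous by (meson continuous_at_imp_continuous_on)
  moreover have "q \<in> ?C" using q by simp
  then have "?C \<noteq> {}" by blast
  ultimately obtain z where z: "z \<in> ?C" "\<And>y. y \<in> ?C \<Longrightarrow> f y \<le> f z"
    using continuous_attains_sup[OF compact] by blast
  then obtain p where p: "p \<in> topspace M" "z = F p" by auto
  have max: "f (F p') \<le> f (F p)" if "p' \<in> topspace M" "F p' \<in> D" for p'
    using z that p by (cases "f q \<le> f (F p')") auto
  have "p \<in> manifold_boundary \<A>"
  proof (rule ccontr)
    assume "p \<notin> manifold_boundary \<A>"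
    moreover have "F p \<in> D" using z p by simp
    ultimately obtain u :: "'n \<Rightarrow> _" and \<nu> where "adapted_frame u \<nu>"
      "(\<Sum>k\<in>UNIV. H (F p) (u k) \<bullet> u k) + g (F p) \<bullet> e_last \<le> 0"
      using maximum_principle[OF p(1) _ f g \<open>open D\<close> _ max] by blast
    then show False using strict[of u \<nu> "F p"] by simp
  qed
  then show thesis using that[of z] z p by auto
qed

section \<open>Barrier functions\<close>

lemma DIM_ambient: "DIM((real ^ 'n) \<times> real) = CARD('n) + 1"
  by simp

lemma e_last_norm: "norm (e_last :: (real ^ 'n) \<times> real) = 1"
  by (simp add: e_last_def norm_Pair)

text \<open>The drift Laplacian of \<open>exp (a \<bullet> x)\<close> is this function times \<open>norm\<^sup>2\<close> of the tangential part of \<open>a\<close>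
  plus \<open>a \<bullet> e_last\<close>, which is negative as soon as \<open>a\<close> points downwards and is short. Linear functions of the
  horizontal coordinates have drift Laplacian zero, so subtracting such an exponential makes them strict
  subsolutions.\<close>

lemma exponential_strict_subsolution:
  fixes a b :: "(real ^ 'n) \<times> real" and c :: real and u :: "'n \<Rightarrow> (real ^ 'n) \<times> real"
  defines "f \<equiv> \<lambda>x. b \<bullet> x - c * exp (a \<bullet> x)"
    and "g \<equiv> \<lambda>x. b - (c * exp (a \<bullet> x)) *\<^sub>R a"
    and "H \<equiv> \<lambda>x h. - (c * exp (a \<bullet> x) * (a \<bullet> h)) *\<^sub>R a"
  shows "(f has_derivative (\<lambda>h. g x \<bullet> h)) (at x)"
    and "(g has_derivative H x) (at x)"
    and "\<lbrakk>adapted_frame u \<nu>; 0 < c; b \<bullet> e_last = 0; (norm a)\<^sup>2 + a \<bullet> e_last < 0\<rbrakk> \<Longrightarrow>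
      0 < (\<Sum>k\<in>UNIV. H x (u k) \<bullet> u k) + g x \<bullet> e_last"
proof -
  show "(f has_derivative (\<lambda>h. g x \<bullet> h)) (at x)"
    unfolding f_def g_def by (auto intro!: derivative_eq_intros simp: inner_diff_left)
  show "(g has_derivative H x) (at x)"
    unfolding g_def H_def by (auto intro!: derivative_eq_intros simp: algebra_simps)
  assume *: "adapted_frame u \<nu>" "0 < c" "b \<bullet> e_last = 0" "(norm a)\<^sup>2 + a \<bullet> e_last < 0"
  have "(\<Sum>k\<in>UNIV. (a \<bullet> u k)\<^sup>2) \<le> (norm a)\<^sup>2"
    using adapted_frame_norm[OF *(1) DIM_ambient, of a] zero_le_power2[of "a \<bullet> \<nu>"] by linarith
  then have "c * exp (a \<bullet> x) * ((\<Sum>k\<in>UNIV. (a \<bullet> u k)\<^sup>2) + a \<bullet> e_last) < 0"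
    using * by (intro mult_pos_neg) auto
  also have "c * exp (a \<bullet> x) * ((\<Sum>k\<in>UNIV. (a \<bullet> u k)\<^sup>2) + a \<bullet> e_last) =
      - ((\<Sum>k\<in>UNIV. H x (u k) \<bullet> u k) + g x \<bullet> e_last)"
    using *(3) by (simp add: H_def g_def sum_negf sum_distrib_left inner_diff_left algebra_simps
        power2_eq_square)
  finally show "0 < (\<Sum>k\<in>UNIV. H x (u k) \<bullet> u k) + g x \<bullet> e_last" by simp
qed

text \<open>The largest eigenvalue of \<open>w\<^sub>1 \<otimes> w\<^sub>1 + w\<^sub>2 \<otimes> w\<^sub>2\<close> is \<open>1 + \<bar>w\<^sub>1 \<bullet> w\<^sub>2\<bar>\<close>. For transverse
  directions this is smaller than the trace \<open>2\<close>, so the trace over every hyperplane stays positive.\<close>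

lemma sum_of_squared_inner_le:
  fixes w\<^sub>1 w\<^sub>2 \<nu> :: "'a::euclidean_space"
  assumes "norm w\<^sub>1 = 1" "norm w\<^sub>2 = 1" "norm \<nu> = 1"
  shows "(w\<^sub>1 \<bullet> \<nu>)\<^sup>2 + (w\<^sub>2 \<bullet> \<nu>)\<^sup>2 \<le> 1 + \<bar>w\<^sub>1 \<bullet> w\<^sub>2\<bar>"
proof -
  define s t c where "s = w\<^sub>1 \<bullet> \<nu>" "t = w\<^sub>2 \<bullet> \<nu>" "c = w\<^sub>1 \<bullet> w\<^sub>2"
  define m where "m = s\<^sup>2 + t\<^sup>2"
  have "m = (s *\<^sub>R w\<^sub>1 + t *\<^sub>R w\<^sub>2) \<bullet> \<nu>"
    by (simp add: m_def s_t_c_def inner_add_left power2_eq_square)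
  also have "\<dots> \<le> norm (s *\<^sub>R w\<^sub>1 + t *\<^sub>R w\<^sub>2)"
    using norm_cauchy_schwarz[of "s *\<^sub>R w\<^sub>1 + t *\<^sub>R w\<^sub>2" \<nu>] assms by simp
  finally have "m\<^sup>2 \<le> (norm (s *\<^sub>R w\<^sub>1 + t *\<^sub>R w\<^sub>2))\<^sup>2"
    by (intro power_mono) (auto simp: m_def)
  also have "\<dots> = (s *\<^sub>R w\<^sub>1 + t *\<^sub>R w\<^sub>2) \<bullet> (s *\<^sub>R w\<^sub>1 + t *\<^sub>R w\<^sub>2)"
    by (rule power2_norm_eq_inner)
  also have "\<dots> = m + 2 * (s * t) * c"
  proof -
    have "w\<^sub>1 \<bullet> w\<^sub>1 = 1" "w\<^sub>2 \<bullet> w\<^sub>2 = 1" "w\<^sub>1 \<bullet> w\<^sub>2 = c" "w\<^sub>2 \<bullet> w\<^sub>1 = c"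
      using assms by (auto simp: norm_eq_1 s_t_c_def inner_commute)
    then show ?thesis
      by (simp add: inner_add_left inner_add_right m_def power2_eq_square algebra_simps)
  qed
  also have "2 * (s * t) * c \<le> m * \<bar>c\<bar>"
  proof -
    have "0 \<le> (\<bar>s\<bar> - \<bar>t\<bar>)\<^sup>2" by simp
    then have "2 * \<bar>s * t\<bar> \<le> m" by (simp add: m_def power2_diff abs_mult)
    then have "2 * \<bar>s * t\<bar> * \<bar>c\<bar> \<le> m * \<bar>c\<bar>" by (intro mult_right_mono) auto
    moreover have "2 * (s * t) * c \<le> \<bar>2 * (s * t) * c\<bar>" by (rule abs_ge_self)
    ultimately show ?thesis by (simp add: abs_mult)
  qed
  finally have "m * m \<le> m * (1 + \<bar>c\<bar>)" by (simp add: power2_eq_square algebra_simps)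
  then have "m \<le> 1 + \<bar>c\<bar>"
    by (cases "m = 0") (auto simp: m_def mult_le_cancel_left)
  then show ?thesis by (simp add: m_def s_t_c_def)
qed

lemma square_derivatives:
  fixes w x :: "'a::real_inner"
  shows "((\<lambda>x. (w \<bullet> x - a)\<^sup>2) has_derivative (\<lambda>h. ((2 * (w \<bullet> x - a)) *\<^sub>R w) \<bullet> h)) (at x)"
    and "((\<lambda>x. (2 * (w \<bullet> x - a)) *\<^sub>R w) has_derivative (\<lambda>h. (2 * (w \<bullet> h)) *\<^sub>R w)) (at x)"
  by (auto intro!: derivative_eq_intros)

lemma log_distance_derivatives:
  fixes q x :: "'a::real_inner"
  defines "s \<equiv> \<lambda>x. 1 + (x - q) \<bullet> (x - q)"
  shows "((\<lambda>x. ln (s x)) has_derivative (\<lambda>h. ((2 / s x) *\<^sub>R (x - q)) \<bullet> h)) (at x)"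
    and "((\<lambda>x. (2 / s x) *\<^sub>R (x - q)) has_derivative
      (\<lambda>h. (2 / s x) *\<^sub>R h - (4 * ((x - q) \<bullet> h) / (s x)\<^sup>2) *\<^sub>R (x - q))) (at x)"
proof -
  have pos: "0 < s x" by (simp add: s_def add_pos_nonneg)
  have ds: "(s has_derivative (\<lambda>h. 2 * ((x - q) \<bullet> h))) (at x)"
    unfolding s_def by (auto intro!: derivative_eq_intros simp: inner_commute)
  show "((\<lambda>x. ln (s x)) has_derivative (\<lambda>h. ((2 / s x) *\<^sub>R (x - q)) \<bullet> h)) (at x)"
    using has_derivative_ln[OF pos ds] by (simp add: divide_inverse mult_ac)
  have "((\<lambda>x. 2 / s x) has_derivative (\<lambda>h. - (4 * ((x - q) \<bullet> h) / (s x)\<^sup>2))) (at x)"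
    using pos by (auto intro!: derivative_eq_intros ds simp: power2_eq_square field_simps)
  moreover have "((\<lambda>x. x - q) has_derivative (\<lambda>h. h)) (at x)"
    by (auto intro!: derivative_eq_intros)
  ultimately show "((\<lambda>x. (2 / s x) *\<^sub>R (x - q)) has_derivative
      (\<lambda>h. (2 / s x) *\<^sub>R h - (4 * ((x - q) \<bullet> h) / (s x)\<^sup>2) *\<^sub>R (x - q))) (at x)"
    using has_derivative_scaleR by fastforce
qed

text \<open>The quadratic part contributes at least \<open>2 * (1 - \<bar>w\<^sub>1 \<bullet> w\<^sub>2\<bar>)\<close> to the drift Laplacian on every
  translater, while that of the logarithm is bounded above by \<open>2 n + 1\<close>: its gradient has norm at most
  \<open>1\<close> and its Hessian is at most \<open>2\<close>. A small multiple of the logarithm can therefore be subtracted. This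
  forces decay at infinity, and as the growth is centred at \<open>q\<close>, it costs nothing at \<open>q\<close>.\<close>

lemma quadrant_strict_subsolution:
  fixes w\<^sub>1 w\<^sub>2 q :: "(real ^ 'n) \<times> real" and a\<^sub>1 a\<^sub>2 \<kappa> :: real and u :: "'n \<Rightarrow> (real ^ 'n) \<times> real"
  defines "f \<equiv> \<lambda>x. (w\<^sub>1 \<bullet> x - a\<^sub>1)\<^sup>2 + (w\<^sub>2 \<bullet> x - a\<^sub>2)\<^sup>2 - \<kappa> * ln (1 + (x - q) \<bullet> (x - q))"
    and "g \<equiv> \<lambda>x. (2 * (w\<^sub>1 \<bullet> x - a\<^sub>1)) *\<^sub>R w\<^sub>1 + (2 * (w\<^sub>2 \<bullet> x - a\<^sub>2)) *\<^sub>R w\<^sub>2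
      - \<kappa> *\<^sub>R ((2 / (1 + (x - q) \<bullet> (x - q))) *\<^sub>R (x - q))"
    and "H \<equiv> \<lambda>x h. (2 * (w\<^sub>1 \<bullet> h)) *\<^sub>R w\<^sub>1 + (2 * (w\<^sub>2 \<bullet> h)) *\<^sub>R w\<^sub>2
      - \<kappa> *\<^sub>R ((2 / (1 + (x - q) \<bullet> (x - q))) *\<^sub>R h
         - (4 * ((x - q) \<bullet> h) / (1 + (x - q) \<bullet> (x - q))\<^sup>2) *\<^sub>R (x - q))"
  shows "(f has_derivative (\<lambda>h. g x \<bullet> h)) (at x)"
    and "(g has_derivative H x) (at x)"
    and "\<lbrakk>adapted_frame u \<nu>; norm w\<^sub>1 = 1; norm w\<^sub>2 = 1; w\<^sub>1 \<bullet> e_last = 0; w\<^sub>2 \<bullet> e_last = 0;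
      0 < \<kappa>; (2 * real CARD('n) + 1) * \<kappa> < 2 * (1 - \<bar>w\<^sub>1 \<bullet> w\<^sub>2\<bar>)\<rbrakk> \<Longrightarrow>
      0 < (\<Sum>k\<in>UNIV. H x (u k) \<bullet> u k) + g x \<bullet> e_last"
proof -
  show "(f has_derivative (\<lambda>h. g x \<bullet> h)) (at x)"
    unfolding f_def g_def inner_diff_left[of "_ + _"] inner_add_left inner_scaleR_left[of \<kappa>]
    by (intro has_derivative_diff has_derivative_add has_derivative_mult_right square_derivatives
        log_distance_derivatives)
  show "(g has_derivative H x) (at x)"
    unfolding g_def H_def
    by (intro has_derivative_diff has_derivative_add has_derivative_scaleR_right square_derivatives
        log_distance_derivatives)
  assume *: "adapted_frame u \<nu>" "norm w\<^sub>1 = 1" "norm w\<^sub>2 = 1" "w\<^sub>1 \<bullet> e_last = 0" "w\<^sub>2 \<bullet> e_last = 0"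
      "0 < \<kappa>" "(2 * real CARD('n) + 1) * \<kappa> < 2 * (1 - \<bar>w\<^sub>1 \<bullet> w\<^sub>2\<bar>)"
  define r s where "r = x - q" "s = 1 + r \<bullet> r"
  have s: "1 \<le> s" by (simp add: r_s_def)
  have uu: "u k \<bullet> u k = 1" and n: "norm \<nu> = 1" for k using *(1) by (auto simp: adapted_frame_def)
  have W: "(\<Sum>k\<in>UNIV. (w\<^sub>1 \<bullet> u k)\<^sup>2) + (\<Sum>k\<in>UNIV. (w\<^sub>2 \<bullet> u k)\<^sup>2) \<ge> 1 - \<bar>w\<^sub>1 \<bullet> w\<^sub>2\<bar>"
    using adapted_frame_norm[OF *(1) DIM_ambient, of w\<^sub>1]
      adapted_frame_norm[OF *(1) DIM_ambient, of w\<^sub>2] *(2,3)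
      sum_of_squared_inner_le[OF *(2,3) n] by simp
  have "H x h = (2 * (w\<^sub>1 \<bullet> h)) *\<^sub>R w\<^sub>1 + (2 * (w\<^sub>2 \<bullet> h)) *\<^sub>R w\<^sub>2
      - \<kappa> *\<^sub>R ((2 / s) *\<^sub>R h - (4 * (r \<bullet> h) / s\<^sup>2) *\<^sub>R r)" for h
    by (simp add: H_def r_s_def)
  note H' = this
  have "H x (u k) \<bullet> u k = 2 * (w\<^sub>1 \<bullet> u k)\<^sup>2 + 2 * (w\<^sub>2 \<bullet> u k)\<^sup>2
      - 2 * \<kappa> / s + (4 * \<kappa> / s\<^sup>2) * (r \<bullet> u k)\<^sup>2" for k
    unfolding H' by (simp add: inner_diff_left inner_add_left uu power2_eq_square[of "_ \<bullet> _"] algebra_simps)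
  then have "(\<Sum>k\<in>UNIV. H x (u k) \<bullet> u k) = 2 * ((\<Sum>k\<in>UNIV. (w\<^sub>1 \<bullet> u k)\<^sup>2) + (\<Sum>k\<in>UNIV. (w\<^sub>2 \<bullet> u k)\<^sup>2))
     - (2 * \<kappa> / s) * real CARD('n) + (4 * \<kappa> / s\<^sup>2) * (\<Sum>k\<in>UNIV. (r \<bullet> u k)\<^sup>2)"
    by (simp add: sum.distrib sum_subtractf sum_distrib_left)
  moreover have "(2 * \<kappa> / s) * real CARD('n) \<le> 2 * \<kappa> * real CARD('n)"
    using s *(6) by (simp add: field_simps mult_left_mono)
  moreover have "0 \<le> (4 * \<kappa> / s\<^sup>2) * (\<Sum>k\<in>UNIV. (r \<bullet> u k)\<^sup>2)"
    using *(6) by (intro mult_nonneg_nonneg sum_nonneg) auto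
  moreover have "g x \<bullet> e_last = - (\<kappa> / s) * (2 * (r \<bullet> e_last))"
    using *(4,5) by (simp add: g_def r_s_def inner_diff_left inner_add_left)
  moreover have "(\<kappa> / s) * (2 * (r \<bullet> e_last)) \<le> \<kappa>"
  proof -
    have "r \<bullet> e_last \<le> norm r"
      using norm_cauchy_schwarz[of r e_last] by (simp add: e_last_def norm_Pair)
    moreover have "2 * norm r \<le> s"
      using sum_power2_ge_zero[of "norm r - 1" 0] by (simp add: r_s_def power2_diff power2_norm_eq_inner)
    ultimately have "2 * (r \<bullet> e_last) \<le> s" by simp
    then have "(\<kappa> / s) * (2 * (r \<bullet> e_last)) \<le> (\<kappa> / s) * s"
      using s *(6) by (intro mult_left_mono) auto
    then show ?thesis using s by simp
  qed
  ultimately show "0 < (\<Sum>k\<in>UNIV. H x (u k) \<bullet> u k) + g x \<bullet> e_last"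
    using W *(7) by (simp add: algebra_simps)
qed

section \<open>Translaters in a wedge\<close>

text \<open>In the coordinates \<open>X\<^sub>i = w\<^sub>i \<bullet> x - \<beta>\<^sub>i\<close> the wedge is the quadrant \<open>X\<^sub>1, X\<^sub>2 \<ge> 0\<close>. The
  squared distance to \<open>(a, a)\<close> is at most \<open>a\<^sup>2\<close> on the part of the line \<open>X\<^sub>1 + X\<^sub>2 = a\<close> in the quadrant,
  but close to \<open>2 a\<^sup>2\<close> near the vertex. So, in the triangle cut off by this line, the function of the
  preceding lemma can only be dominated at a point \<open>q\<close> near the vertex by a boundary point of the
  hypersurface; if \<open>q\<close> is far away from all of these, the logarithm excludes this too.\<close>

lemma (in self_translater) bounded_near_vertex:
  assumes proper: "closed (F ` topspace M)" and bd: "bounded (F ` manifold_boundary \<A>)"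
    and w\<^sub>1: "norm w\<^sub>1 = 1" "w\<^sub>1 \<bullet> e_last = 0" and w\<^sub>2: "norm w\<^sub>2 = 1" "w\<^sub>2 \<bullet> e_last = 0"
    and transverse: "\<bar>w\<^sub>1 \<bullet> w\<^sub>2\<bar> < 1"
    and half: "\<And>x. x \<in> F ` topspace M \<Longrightarrow> \<beta>\<^sub>1 \<le> w\<^sub>1 \<bullet> x" "\<And>x. x \<in> F ` topspace M \<Longrightarrow> \<beta>\<^sub>2 \<le> w\<^sub>2 \<bullet> x"
  shows "bounded {x \<in> F ` topspace M. (w\<^sub>1 + w\<^sub>2) \<bullet> x \<le> C}"
proof -
  let ?S = "F ` topspace M"
  define c where "c = max 1 (C - \<beta>\<^sub>1 - \<beta>\<^sub>2)"
  \<comment> \<open>For points with \<open>X\<^sub>1 + X\<^sub>2 \<le> c\<close>, the squared distance to \<open>(a, a)\<close> is at least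
     \<open>2 a\<^sup>2 - 2 a c = 24 c\<^sup>2\<close>, which exceeds \<open>a\<^sup>2 = 16 c\<^sup>2\<close>.\<close>
  define a where "a = 4 * c"
  have c: "0 < c" "C - \<beta>\<^sub>1 - \<beta>\<^sub>2 \<le> c" by (auto simp: c_def)
  define \<kappa> where "\<kappa> = (1 - \<bar>w\<^sub>1 \<bullet> w\<^sub>2\<bar>) / (2 * real CARD('n) + 1)"
  have \<kappa>: "0 < \<kappa>" "(2 * real CARD('n) + 1) * \<kappa> < 2 * (1 - \<bar>w\<^sub>1 \<bullet> w\<^sub>2\<bar>)"
    using transverse by (auto simp: \<kappa>_def add_pos_pos)
  obtain \<rho> where \<rho>: "\<And>x. x \<in> F ` manifold_boundary \<A> \<Longrightarrow> norm x \<le> \<rho>"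
    using bd unfolding bounded_iff by blast
  define R where "R = sqrt (exp (a\<^sup>2 / \<kappa>))"
  have "norm q \<le> \<rho> + R" if q: "q \<in> ?S" "(w\<^sub>1 + w\<^sub>2) \<bullet> q \<le> C" for q
  proof (rule ccontr)
    assume far: "\<not> norm q \<le> \<rho> + R"
    define X\<^sub>1 X\<^sub>2 where "X\<^sub>1 = (\<lambda>x. w\<^sub>1 \<bullet> x - \<beta>\<^sub>1)" "X\<^sub>2 = (\<lambda>x. w\<^sub>2 \<bullet> x - \<beta>\<^sub>2)"
    define D where "D = {x. X\<^sub>1 x + X\<^sub>2 x < a}"
    define L where "L = (\<lambda>x. ln (1 + (x - q) \<bullet> (x - q)))"
    define f where "f = (\<lambda>x. (w\<^sub>1 \<bullet> x - (\<beta>\<^sub>1 + a))\<^sup>2 + (w\<^sub>2 \<bullet> x - (\<beta>\<^sub>2 + a))\<^sup>2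
      - \<kappa> * ln (1 + (x - q) \<bullet> (x - q)))"
    have fX: "f x = 2 * a\<^sup>2 - 2 * a * (X\<^sub>1 x + X\<^sub>2 x) + (X\<^sub>1 x)\<^sup>2 + (X\<^sub>2 x)\<^sup>2 - \<kappa> * L x" for x
      unfolding f_def L_def X\<^sub>1_X\<^sub>2_def by (simp add: power2_eq_square algebra_simps)
    have Xpos: "0 \<le> X\<^sub>1 x" "0 \<le> X\<^sub>2 x" if "x \<in> ?S" for x
      using half that by (auto simp: X\<^sub>1_X\<^sub>2_def)
    have Lpos: "0 \<le> L x" for x by (simp add: L_def)
    have Xsq: "(X\<^sub>1 x)\<^sup>2 + (X\<^sub>2 x)\<^sup>2 \<le> (X\<^sub>1 x + X\<^sub>2 x)\<^sup>2" if "x \<in> ?S" for x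
      using Xpos[OF that] by (simp add: power2_sum)
    have fq: "24 * c\<^sup>2 \<le> f q"
    proof -
      have "X\<^sub>1 q + X\<^sub>2 q \<le> c" using q(2) c(2) by (simp add: X\<^sub>1_X\<^sub>2_def inner_add_left)
      then have "2 * a * (X\<^sub>1 q + X\<^sub>2 q) \<le> 2 * a * c" using c(1) by (intro mult_left_mono) (auto simp: a_def)
      moreover have "\<kappa> * L q = 0" by (simp add: L_def)
      ultimately have "2 * a\<^sup>2 - 2 * a * c \<le> f q"
        unfolding fX using zero_le_power2[of "X\<^sub>1 q"] zero_le_power2[of "X\<^sub>2 q"] by linarith
      then show ?thesis by (simp add: a_def power2_eq_square)
    qed
    have upper: "f x \<le> 2 * a\<^sup>2 - \<kappa> * L x" if x: "x \<in> ?S" "X\<^sub>1 x + X\<^sub>2 x \<le> a" for x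
    proof -
      have "(X\<^sub>1 x + X\<^sub>2 x)\<^sup>2 \<le> 2 * a * (X\<^sub>1 x + X\<^sub>2 x)"
        using x(2) Xpos[OF x(1)] by (simp add: power2_eq_square mult_right_mono)
      with Xsq[OF x(1)] show ?thesis unfolding fX by linarith
    qed
    have edge: "f x < f q" if x: "x \<in> ?S" "X\<^sub>1 x + X\<^sub>2 x = a" for x
    proof -
      have "f x \<le> a\<^sup>2"
      proof -
        have "0 \<le> \<kappa> * L x" using Lpos[of x] \<kappa>(1) by simp
        then show ?thesis
          using Xsq[OF x(1)] unfolding fX x(2) by (simp add: power2_eq_square)
      qed
      also have "\<dots> < 24 * c\<^sup>2" using c(1) by (simp add: a_def power_mult_distrib)
      also have "\<dots> \<le> f q" by (rule fq)
      finally show ?thesis .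
    qed
    have logb: "(norm (x - q))\<^sup>2 \<le> exp ((2 * a\<^sup>2 - 24 * c\<^sup>2) / \<kappa>)"
      if x: "x \<in> ?S" "X\<^sub>1 x + X\<^sub>2 x \<le> a" "f q \<le> f x" for x
    proof -
      have "\<kappa> * L x \<le> 2 * a\<^sup>2 - 24 * c\<^sup>2" using upper[OF x(1,2)] x(3) fq by linarith
      then have "L x \<le> (2 * a\<^sup>2 - 24 * c\<^sup>2) / \<kappa>" using \<kappa>(1) by (simp add: field_simps)
      then have "exp (L x) \<le> exp ((2 * a\<^sup>2 - 24 * c\<^sup>2) / \<kappa>)" by simp
      moreover have "exp (L x) = 1 + (norm (x - q))\<^sup>2"
        by (simp add: L_def add_pos_nonneg power2_norm_eq_inner)
      ultimately show ?thesis by simp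
    qed
    have eqC: "{y \<in> ?S \<inter> D. f q \<le> f y} = ?S \<inter> {y. X\<^sub>1 y + X\<^sub>2 y \<le> a} \<inter> {y. f q \<le> f y}"
      using edge by (fastforce simp: D_def less_le)
    have comp: "compact {y \<in> ?S \<inter> D. f q \<le> f y}"
    proof -
      have nz: "1 + (y - q) \<bullet> (y - q) \<noteq> 0" for y
        by (metis add_pos_nonneg inner_ge_zero less_irrefl zero_less_one)
      have "continuous_on UNIV f"
        unfolding f_def by (intro continuous_intros) (use nz in auto)
      moreover have "continuous_on UNIV (\<lambda>y. X\<^sub>1 y + X\<^sub>2 y)"
        unfolding X\<^sub>1_X\<^sub>2_def by (intro continuous_intros)
      ultimately have "closed {y \<in> ?S \<inter> D. f q \<le> f y}"
        unfolding eqC by (intro closed_Int proper closed_Collect_le continuous_on_const)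
      moreover have "bounded {y \<in> ?S \<inter> D. f q \<le> f y}"
      proof (rule bounded_subset[OF bounded_cball])
        show "{y \<in> ?S \<inter> D. f q \<le> f y} \<subseteq> cball q (sqrt (exp ((2 * a\<^sup>2 - 24 * c\<^sup>2) / \<kappa>)))"
        proof
          fix y assume "y \<in> {y \<in> ?S \<inter> D. f q \<le> f y}"
          then have "(norm (y - q))\<^sup>2 \<le> exp ((2 * a\<^sup>2 - 24 * c\<^sup>2) / \<kappa>)"
            using logb unfolding eqC by blast
          then show "y \<in> cball q (sqrt (exp ((2 * a\<^sup>2 - 24 * c\<^sup>2) / \<kappa>)))"
            by (simp add: dist_norm norm_minus_commute real_le_rsqrt)
        qed
      qed
      ultimately show ?thesis by (simp add: compact_eq_bounded_closed)
    qed
    have D: "open D"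
      unfolding D_def X\<^sub>1_X\<^sub>2_def by (intro open_Collect_less continuous_intros)
    have "q \<in> D"
      using q(2) c by (simp add: D_def X\<^sub>1_X\<^sub>2_def inner_add_left a_def)
    obtain z where z: "z \<in> F ` manifold_boundary \<A>" "z \<in> D" "f q \<le> f z"
      by (rule strict_subsolution_boundary_bound[where f = f and D = D and q = q, OF
          quadrant_strict_subsolution(1)[of w\<^sub>1 "\<beta>\<^sub>1 + a" w\<^sub>2 "\<beta>\<^sub>2 + a" \<kappa> q, folded f_def]
          quadrant_strict_subsolution(2)[of w\<^sub>1 "\<beta>\<^sub>1 + a" w\<^sub>2 "\<beta>\<^sub>2 + a" \<kappa> q],
          OF D q(1) \<open>q \<in> D\<close>
          quadrant_strict_subsolution(3)[OF _ w\<^sub>1(1) w\<^sub>2(1) w\<^sub>1(2) w\<^sub>2(2) \<kappa>] comp])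
    have "z \<in> ?S"
      using z(1) cover by (auto simp: manifold_boundary_def)
    then have "(norm (z - q))\<^sup>2 \<le> exp ((2 * a\<^sup>2 - 24 * c\<^sup>2) / \<kappa>)"
      using logb z by (auto simp: D_def)
    also have "\<dots> \<le> exp (a\<^sup>2 / \<kappa>)"
      using \<kappa>(1) by (simp add: a_def power_mult_distrib divide_right_mono)
    finally have "norm (z - q) \<le> R" unfolding R_def by (rule real_le_rsqrt)
    moreover have "norm q \<le> norm z + norm (z - q)"
      by (metis norm_minus_commute norm_triangle_sub)
    ultimately show False using far \<rho>[OF z(1)] by linarith
  qed
  then show ?thesis unfolding bounded_iff by blast
qed

lemma (in self_translater) exponential_boundary_bound:
  fixes a b :: "(real ^ 'n) \<times> real"
  assumes "q \<in> F ` topspace M" "0 < c" "b \<bullet> e_last = 0" "(norm a)\<^sup>2 + a \<bullet> e_last < 0"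
    and "closed (F ` topspace M)"
    and "bounded {x \<in> F ` topspace M. b \<bullet> q - c * exp (a \<bullet> q) \<le> b \<bullet> x - c * exp (a \<bullet> x)}"
  obtains z where "z \<in> F ` manifold_boundary \<A>"
    "b \<bullet> q - c * exp (a \<bullet> q) \<le> b \<bullet> z - c * exp (a \<bullet> z)"
proof -
  let ?f = "\<lambda>x. b \<bullet> x - c * exp (a \<bullet> x)"
  have "closed (F ` topspace M \<inter> {x. ?f q \<le> ?f x})"
    by (intro closed_Int assms closed_Collect_le continuous_intros)
  then have comp: "compact {x \<in> F ` topspace M \<inter> UNIV. ?f q \<le> ?f x}"
    using assms(6) by (simp add: compact_eq_bounded_closed Collect_conj_eq)
  obtain z where "z \<in> F ` manifold_boundary \<A>" "z \<in> UNIV" "?f q \<le> ?f z"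
    by (rule strict_subsolution_boundary_bound[where f = ?f and D = UNIV and q = q,
          OF exponential_strict_subsolution(1,2), OF open_UNIV assms(1) UNIV_I
            exponential_strict_subsolution(3)[OF _ assms(2-4)] comp])
  then show thesis using that by blast
qed

lemma exp_linear_bound:
  fixes \<delta> K :: real
  assumes "0 < \<delta>"
  obtains B where "\<And>t. K \<le> t - \<delta> * exp (t / 8) \<Longrightarrow> t \<le> B"
proof (rule that[of "max 1 (256 * (2 + \<bar>K\<bar>) / \<delta>)"], rule ccontr)
  fix t assume K: "K \<le> t - \<delta> * exp (t / 8)" and "\<not> t \<le> max 1 (256 * (2 + \<bar>K\<bar>) / \<delta>)"
  then have "1 < t" "256 * (2 + \<bar>K\<bar>) / \<delta> < t" by auto
  then have t: "1 < t" "256 * (2 + \<bar>K\<bar>) \<le> \<delta> * t"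
    using assms by (simp_all add: pos_divide_less_eq mult.commute)
  have "t / 16 \<le> exp (t / 16)" using exp_ge_add_one_self[of "t / 16"] by linarith
  then have "(t / 16)\<^sup>2 \<le> (exp (t / 16))\<^sup>2" using t by (intro power_mono) auto
  also have "\<dots> = exp (t / 8)" by (simp add: power2_eq_square exp_add[symmetric])
  finally have "\<delta> * (t\<^sup>2 / 256) \<le> \<delta> * exp (t / 8)"
    using assms by (intro mult_left_mono) (auto simp: power_divide)
  moreover have "256 * (2 + \<bar>K\<bar>) * t \<le> \<delta> * t * t"
    using t by (intro mult_right_mono) auto
  moreover have "1 * \<bar>K\<bar> \<le> t * \<bar>K\<bar>" using t by (intro mult_right_mono) auto
  ultimately show False using K t(1) by (simp add: power2_eq_square algebra_simps)
qed

theorem theorem2: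
  fixes M :: "'m topology"
    and \<A> :: "('m, 'n::finite) chart set"
    and F :: "'m \<Rightarrow> (real ^ 'n) \<times> real"
  assumes "self_translater M \<A> F"
    and "proper_map M euclidean F"
    and "connected_space M"
    and "in_two_transverse_vertical_halfspaces (F ` topspace M)"
    and "compactin M (manifold_boundary \<A>)"
  shows "compact_space M"
proof -
  interpret self_translater M \<A> F by (rule assms(1))
  let ?S = "F ` topspace M" and ?B = "F ` manifold_boundary \<A>"
  have closed: "closed ?S"
  proof -
    have "closed_map M euclidean F" using assms(2) by (simp add: proper_map_def)
    then have "closedin euclidean ?S" unfolding closed_map_def using closedin_topspace by blast
    then show ?thesis by simp
  qed
  have bd: "bounded ?B"
    using image_compactin[OF assms(5) continuous_immersion] by (simp add: compact_imp_bounded)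
  obtain b\<^sub>1 w\<^sub>1 b\<^sub>2 w\<^sub>2 where w: "vertical_direction w\<^sub>1" "vertical_direction w\<^sub>2"
    "w\<^sub>1 \<noteq> w\<^sub>2" "w\<^sub>1 \<noteq> - w\<^sub>2" and sub: "?S \<subseteq> halfspace b\<^sub>1 w\<^sub>1 \<inter> halfspace b\<^sub>2 w\<^sub>2"
    using assms(4) unfolding in_two_transverse_vertical_halfspaces_def by metis
  have w\<^sub>1: "norm w\<^sub>1 = 1" "w\<^sub>1 \<bullet> e_last = 0" and w\<^sub>2: "norm w\<^sub>2 = 1" "w\<^sub>2 \<bullet> e_last = 0"
    using w by (auto simp: vertical_direction_def)
  have transverse: "\<bar>w\<^sub>1 \<bullet> w\<^sub>2\<bar> < 1"
    using norm_cauchy_schwarz_abs_eq[of w\<^sub>1 w\<^sub>2] Cauchy_Schwarz_ineq2[of w\<^sub>1 w\<^sub>2] w w\<^sub>1 w\<^sub>2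
    by auto
  define v where "v = w\<^sub>1 + w\<^sub>2"
  have half: "b\<^sub>1 \<bullet> w\<^sub>1 \<le> w\<^sub>1 \<bullet> x \<and> b\<^sub>2 \<bullet> w\<^sub>2 \<le> w\<^sub>2 \<bullet> x" if "x \<in> ?S" for x
    using subsetD[OF sub that] by (simp add: halfspace_def inner_diff_right inner_commute[of _ x]
        inner_commute[of "_ - _"] inner_commute[of b\<^sub>1] inner_commute[of b\<^sub>2])
  have near: "bounded {x \<in> ?S. v \<bullet> x \<le> C}" for C
    unfolding v_def
    by (rule bounded_near_vertex[OF closed bd w\<^sub>1 w\<^sub>2 transverse, of "b\<^sub>1 \<bullet> w\<^sub>1" "b\<^sub>2 \<bullet> w\<^sub>2"])
      (use half in auto)
  have v: "norm v \<le> 2" "v \<bullet> e_last = 0"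
    using norm_triangle_ineq[of w\<^sub>1 w\<^sub>2] w\<^sub>1 w\<^sub>2 by (auto simp: v_def inner_add_left)
  obtain \<rho> where \<rho>: "\<And>x. x \<in> ?B \<Longrightarrow> norm x \<le> \<rho>"
    using bd unfolding bounded_iff by blast
  have vB: "\<bar>v \<bullet> z\<bar> \<le> 2 * \<rho>" and eB: "e_last \<bullet> z \<le> \<rho>" if "z \<in> ?B" for z
  proof -
    have "\<bar>v \<bullet> z\<bar> \<le> norm v * norm z" by (rule Cauchy_Schwarz_ineq2)
    also have "\<dots> \<le> 2 * \<rho>" using v(1) \<rho>[OF that] by (intro mult_mono) auto
    finally show "\<bar>v \<bullet> z\<bar> \<le> 2 * \<rho>" .
    show "e_last \<bullet> z \<le> \<rho>"
      using norm_cauchy_schwarz[of e_last z] \<rho>[OF that] by (simp add: e_last_norm)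
  qed
  have ee: "e_last \<bullet> (e_last :: (real ^ 'n) \<times> real) = 1" using e_last_norm by (simp add: norm_eq_1)
  have height: "e_last \<bullet> q \<le> \<rho>" if q: "q \<in> ?S" for q
  proof (rule ccontr)
    assume "\<not> e_last \<bullet> q \<le> \<rho>"
    define a :: "(real ^ 'n) \<times> real" where "a = (- 1 / 2) *\<^sub>R e_last"
    have a: "a \<bullet> x = - (e_last \<bullet> x) / 2" for x by (simp add: a_def)
    define d where "d = exp (- \<rho> / 2) - exp (a \<bullet> q)"
    have "0 < d" using \<open>\<not> e_last \<bullet> q \<le> \<rho>\<close> by (simp add: d_def a)
    \<comment> \<open>The exponential at \<open>q\<close> falls short of its values on the boundary by at least \<open>d\<close>; this \<open>c\<close> makes
       the gap \<open>c * d\<close> exceed any possible difference in the linear term.\<close>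
    define c where "c = (2 * \<bar>\<rho>\<bar> + \<bar>v \<bullet> q\<bar> + 1) / d"
    have c: "0 < c" using \<open>0 < d\<close> by (simp add: c_def)
    have "{x \<in> ?S. (- v) \<bullet> q - c * exp (a \<bullet> q) \<le> (- v) \<bullet> x - c * exp (a \<bullet> x)}
        \<subseteq> {x \<in> ?S. v \<bullet> x \<le> v \<bullet> q + c * exp (a \<bullet> q)}" (is "?L \<subseteq> ?R")
    proof
      fix x assume x: "x \<in> ?L"
      have "0 < c * exp (a \<bullet> x)" using c by simp
      then show "x \<in> ?R" using x by simp
    qed
    then have bd': "bounded {x \<in> ?S. (- v) \<bullet> q - c * exp (a \<bullet> q) \<le> (- v) \<bullet> x - c * exp (a \<bullet> x)}"
      using near bounded_subset by blast
    have a_neg: "(norm a)\<^sup>2 + a \<bullet> e_last < 0"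
      by (simp add: a ee) (simp add: a_def e_last_norm power2_eq_square)
    have "(- v) \<bullet> e_last = 0" using v(2) by simp
    then obtain z where z: "z \<in> ?B"
      "(- v) \<bullet> q - c * exp (a \<bullet> q) \<le> (- v) \<bullet> z - c * exp (a \<bullet> z)"
      by (rule exponential_boundary_bound[OF q c _ a_neg closed bd'])
    have "exp (- \<rho> / 2) \<le> exp (a \<bullet> z)" using eB[OF z(1)] by (simp add: a)
    then have "c * exp (- \<rho> / 2) \<le> c * exp (a \<bullet> z)" using c by simp
    then have "c * d \<le> 2 * \<rho> + v \<bullet> q"
      using z(2) vB[OF z(1)] by (simp add: d_def algebra_simps)
    moreover have "c * d = 2 * \<bar>\<rho>\<bar> + \<bar>v \<bullet> q\<bar> + 1" using \<open>0 < d\<close> by (simp add: c_def)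
    ultimately show False by simp
  qed
  have "v \<bullet> q \<le> 2 * \<rho> + 1" if q: "q \<in> ?S" for q
  proof -
    define a where "a = (1 / 8) *\<^sub>R v - (1 / 2) *\<^sub>R e_last"
    have a: "a \<bullet> x = (v \<bullet> x) / 8 - (e_last \<bullet> x) / 2" for x by (simp add: a_def inner_diff_left)
    \<comment> \<open>Normalised so that the exponential term equals \<open>1\<close> at \<open>q\<close>.\<close>
    define c where "c = exp (- (a \<bullet> q))"
    have c: "0 < c" "c * exp (a \<bullet> q) = 1" by (auto simp: c_def exp_minus)
    obtain K where K: "\<And>t. v \<bullet> q - 1 \<le> t - (c * exp (- \<rho> / 2)) * exp (t / 8) \<Longrightarrow> t \<le> K"
      using exp_linear_bound[of "c * exp (- \<rho> / 2)" "v \<bullet> q - 1"] c by auto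
    have "{x \<in> ?S. v \<bullet> q - c * exp (a \<bullet> q) \<le> v \<bullet> x - c * exp (a \<bullet> x)}
        \<subseteq> {x \<in> ?S. v \<bullet> x \<le> K}" (is "?L \<subseteq> ?R")
    proof
      fix x assume x: "x \<in> ?L"
      then have "(c * exp (- \<rho> / 2)) * exp (v \<bullet> x / 8) \<le> c * exp (a \<bullet> x)"
        using height[of x] c(1) by (simp add: mult.assoc exp_add[symmetric] a)
      then show "x \<in> ?R" using x K[of "v \<bullet> x"] c(2) by simp
    qed
    then have bd': "bounded {x \<in> ?S. v \<bullet> q - c * exp (a \<bullet> q) \<le> v \<bullet> x - c * exp (a \<bullet> x)}"
      using near bounded_subset by blast
    have a_neg: "(norm a)\<^sup>2 + a \<bullet> e_last < 0"
    proof -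
      have "(norm a)\<^sup>2 = a \<bullet> a" by (rule power2_norm_eq_inner)
      also have "\<dots> = (v \<bullet> v) / 64 + 1 / 4"
        using v(2) ee by (simp add: a) (simp add: a_def inner_diff_right inner_commute)
      also have "v \<bullet> v \<le> 4"
        using power_mono[OF v(1), of 2] by (simp add: power2_norm_eq_inner)
      finally have "(norm a)\<^sup>2 \<le> 4 / 64 + 1 / 4" by simp
      then show ?thesis using v(2) ee by (simp add: a)
    qed
    obtain z where z: "z \<in> ?B" "v \<bullet> q - c * exp (a \<bullet> q) \<le> v \<bullet> z - c * exp (a \<bullet> z)"
      by (rule exponential_boundary_bound[OF q c(1) v(2) a_neg closed bd'])
    have "0 < c * exp (a \<bullet> z)" using c by simp
    then show ?thesis using z(2) vB[OF z(1)] c(2) by linarith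
  qed
  then have "?S \<subseteq> {x \<in> ?S. v \<bullet> x \<le> 2 * \<rho> + 1}" by blast
  with near have "bounded ?S" by (rule bounded_subset)
  with closed have "compact ?S" by (simp add: compact_eq_bounded_closed)
  then have "compactin M {x \<in> topspace M. F x \<in> ?S}"
    using compactin_proper_map_preimage[OF assms(2)] by simp
  moreover have "{x \<in> topspace M. F x \<in> ?S} = topspace M" by blast
  ultimately show ?thesis by (simp add: compact_space_def)
qed

end
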